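(* Let $n=2m$ be an even positive integer, and let $X$ be a Seidel matrix chosen uniformly at random among the $2^{\binom n2}$ Seidel matrices of tournaments of order $n$. Then $\mathbb{E}(\det X)=(n-1)!!$.
   Context: A tournament of order $n$ is a digraph on $\{1,\dots,n\}$ with exactly one of the arcs $ij$, $ji$ for each pair $i\ne j$. Its Seidel matrix $S=[s_{ij}]$ is the $n\times n$ skew-symmetric matrix with zero diagonal, $s_{ij}=1$ if $ij$ is an arc and $s_{ij}=-1$ otherwise. Equivalently, a uniformly random Seidel matrix has independent entries $s_{ij}$, $i<j$, each equal to $\pm1$ with probability $1/2$. The double factorial is defined by $0!!=1!!=1$ and $n!!=n\cdot(n-2)!!$ for $n\ge 2$. *)

theory Defs
  imports
    "HOL-Probability.Probability_Mass_Function"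
    "Jordan_Normal_Form.Determinant"
    "Graph_Theory.Pair_Digraph"
begin

definition is_tournament :: "nat \<Rightarrow> nat pair_pre_digraph \<Rightarrow> bool" where
  "is_tournament n T \<longleftrightarrow>
     pair_digraph T \<and> pverts T = {1..n} \<and>
     (\<forall>i\<in>{1..n}. \<forall>j\<in>{1..n}. i \<noteq> j \<longrightarrow>
        ((i, j) \<in> parcs T \<longleftrightarrow> (j, i) \<notin> parcs T))"

(* Matrix indices start at 0, vertices at 1: row i and column j belong to the
   vertices Suc i and Suc j. *)
definition seidel_matrix :: "nat \<Rightarrow> nat pair_pre_digraph \<Rightarrow> real mat" where
  "seidel_matrix n T = mat n n (\<lambda>(i, j).
     if i = j then 0 else if (Suc i, Suc j) \<in> parcs T then 1 else - 1)"

definition seidel_matrices :: "nat \<Rightarrow> real mat set" where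
  "seidel_matrices n = seidel_matrix n ` {T. is_tournament n T}"

fun double_factorial :: "nat \<Rightarrow> nat" where
  "double_factorial 0 = 1"
| "double_factorial (Suc 0) = 1"
| "double_factorial (Suc (Suc n)) = Suc (Suc n) * double_factorial n"

lemma seidel_matrix_skew_symmetric:
  assumes "is_tournament n T"
  shows "transpose_mat (seidel_matrix n T) = - seidel_matrix n T"
proof (rule eq_matI)
  fix i j
  assume "i < dim_row (- seidel_matrix n T)" "j < dim_col (- seidel_matrix n T)"
  then have ij: "i < n" "j < n" by (auto simp: seidel_matrix_def)
  have "i = j \<or> ((Suc i, Suc j) \<in> parcs T \<and> (Suc j, Suc i) \<notin> parcs T)
      \<or> ((Suc i, Suc j) \<notin> parcs T \<and> (Suc j, Suc i) \<in> parcs T)"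
  proof (cases "i = j")
    case False
    moreover have "Suc i \<in> {1..n}" "Suc j \<in> {1..n}" using ij by auto
    ultimately show ?thesis using assms unfolding is_tournament_def by blast
  qed simp
  then show "transpose_mat (seidel_matrix n T) $$ (i, j) = (- seidel_matrix n T) $$ (i, j)"
    using ij by (elim disjE) (simp_all add: seidel_matrix_def)
qed (auto simp: seidel_matrix_def)

(* The set of Seidel matrices is finite and nonempty, so pmf_of_set is not
   degenerate on it. *)
lemma card_seidel_matrices: "card (seidel_matrices n) = 2 ^ (n choose 2)"
proof -
  define P where "P = (SIGMA j:{1..n}. {1..<j})"
  define tour where "tour A = \<lparr>pverts = {1..n}, parcs = A \<union> prod.swap ` (P - A)\<rparr>" for A
  have fin: "finite P" by (simp add: P_def)
  have card_P: "card P = n choose 2"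
    unfolding P_def by (induction n) (auto simp: atLeastAtMostSuc_conv numeral_2_eq_2)
  have mem_P: "(i, j) \<in> P \<longleftrightarrow> 1 \<le> j \<and> j < i \<and> i \<le> n" for i j
    by (auto simp: P_def)
  have arcs_tour: "(i, j) \<in> parcs (tour A) \<longleftrightarrow> (i, j) \<in> A \<or> ((j, i) \<in> P \<and> (j, i) \<notin> A)"
    for A i j
    by (force simp: tour_def)
  have tour: "is_tournament n (tour A)" if "A \<subseteq> P" for A
  proof -
    have A: "1 \<le> j \<and> j < i \<and> i \<le> n" if "(i, j) \<in> A" for i j
      using that \<open>A \<subseteq> P\<close> mem_P by blast
    have "pair_digraph (tour A)"
    proof unfold_locales
      show "finite (parcs (tour A))"
        using finite_subset[OF \<open>A \<subseteq> P\<close> fin] fin by (simp add: tour_def)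
    qed (auto simp: tour_def mem_P dest!: A)
    moreover have "(i, j) \<in> parcs (tour A) \<longleftrightarrow> (j, i) \<notin> parcs (tour A)"
      if "i \<in> {1..n}" "j \<in> {1..n}" "i \<noteq> j" for i j
      using that A[of i j] A[of j i] by (auto simp: arcs_tour mem_P)
    moreover have "pverts (tour A) = {1..n}"
      by (simp add: tour_def)
    ultimately show ?thesis
      unfolding is_tournament_def by blast
  qed
  have entry: "A = {(i, j) \<in> P. seidel_matrix n (tour A) $$ (i - 1, j - 1) = 1}"
    if "A \<subseteq> P" for A
  proof -
    have "(i, j) \<in> A \<longleftrightarrow> seidel_matrix n (tour A) $$ (i - 1, j - 1) = 1" if "(i, j) \<in> P" for i j
    proof -
      have "(j, i) \<notin> P" "1 \<le> j" "j < i" "i \<le> n" using that by (auto simp: mem_P)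
      then show ?thesis by (auto simp: seidel_matrix_def tour_def)
    qed
    then show ?thesis using that by auto
  qed
  have "bij_betw (\<lambda>A. seidel_matrix n (tour A)) (Pow P) (seidel_matrices n)"
  proof (rule bij_betw_imageI)
    show "inj_on (\<lambda>A. seidel_matrix n (tour A)) (Pow P)"
    proof (rule inj_onI)
      fix A B
      assume "A \<in> Pow P" "B \<in> Pow P" and eq: "seidel_matrix n (tour A) = seidel_matrix n (tour B)"
      then have "A \<subseteq> P" "B \<subseteq> P" by auto
      note entry[OF this(1), unfolded eq]
      also note entry[OF \<open>B \<subseteq> P\<close>, symmetric]
      finally show "A = B" .
    qed
    have "seidel_matrix n T \<in> (\<lambda>A. seidel_matrix n (tour A)) ` Pow P"
      if T: "is_tournament n T" for T
    proof -
      have arcs: "(i, j) \<in> parcs T \<longleftrightarrow> (i, j) \<in> parcs (tour (parcs T \<inter> P))"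
        if "i \<in> {1..n}" "j \<in> {1..n}" "i \<noteq> j" for i j
      proof -
        have "(i, j) \<in> parcs T \<longleftrightarrow> (j, i) \<notin> parcs T"
          using T that unfolding is_tournament_def by blast
        moreover have "(i, j) \<in> P \<longleftrightarrow> (j, i) \<notin> P"
          using that by (auto simp: mem_P)
        ultimately show ?thesis
          unfolding arcs_tour by blast
      qed
      have "seidel_matrix n T = seidel_matrix n (tour (parcs T \<inter> P))"
        by (rule eq_matI) (auto simp: seidel_matrix_def arcs)
      then show ?thesis by blast
    qed
    then show "(\<lambda>A. seidel_matrix n (tour A)) ` Pow P = seidel_matrices n"
      using tour by (auto simp: seidel_matrices_def)
  qed
  then have "card (seidel_matrices n) = card (Pow P)"
    by (simp add: bij_betw_same_card)
  then show ?thesis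
    by (simp add: card_Pow fin card_P)
qed

end

theory Submission
  imports Defs
begin

text \<open>Expand the determinant over permutations and average each term. If a permutation p has a
  point a with p (p a) \<noteq> a, reversing the arc between a and p a negates its term, so the
  term averages to zero; fixed points contribute zero because the diagonal vanishes. Every
  fixed-point-free involution contributes exactly 1, as it has sign (-1)^m and the skew-symmetric
  entries multiply to (-1)^m, and there are (2m - 1)!! of those.\<close>

section \<open>Counting fixed-point-free involutions\<close>

text \<open>These are the perfect matchings of \<open>A\<close>, each point being mapped to its
  partner. Since \<open>permutes\<close> forces the identity outside \<open>A\<close>, a matching is
  represented by exactly one function.\<close>

definition fpf_involutions :: "'a set \<Rightarrow> ('a \<Rightarrow> 'a) set" where
  "fpf_involutions A = {p. p permutes A \<and> (\<forall>i\<in>A. p i \<noteq> i \<and> p (p i) = i)}"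

lemma finite_fpf_involutions: "finite A \<Longrightarrow> finite (fpf_involutions A)"
  by (rule finite_subset[OF _ finite_permutations[of A]]) (auto simp: fpf_involutions_def)

text \<open>Adds the edge {a, b} to a matching \<open>q\<close> of the other points. As
  \<open>q\<close> fixes \<open>a\<close> and \<open>b\<close>, the transposition swaps these two
  and does not affect the values of \<open>q\<close> elsewhere.\<close>

lemma fpf_involutions_insert_pair:
  assumes "a \<in> A" "b \<in> A" "b \<noteq> a" and q: "q \<in> fpf_involutions (A - {a, b})"
  shows "Transposition.transpose a b \<circ> q \<in> fpf_involutions A"
    and "(Transposition.transpose a b \<circ> q) a = b" and "(Transposition.transpose a b \<circ> q) b = a"
    and "\<And>i. i \<in> A - {a, b} \<Longrightarrow> (Transposition.transpose a b \<circ> q) i = q i"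
proof -
  have perm: "q permutes A - {a, b}"
    and inv: "\<And>i. i \<in> A - {a, b} \<Longrightarrow> q i \<noteq> i \<and> q (q i) = i"
    using q by (auto simp: fpf_involutions_def)
  have outside: "q a = a" "q b = b"
    using perm by (auto simp: permutes_def)
  have inside: "q i \<in> A - {a, b}" if "i \<in> A - {a, b}" for i
    using permutes_in_image[OF perm] that by blast
  show ab: "(Transposition.transpose a b \<circ> q) a = b" "(Transposition.transpose a b \<circ> q) b = a"
    by (simp_all add: outside)
  show rest: "(Transposition.transpose a b \<circ> q) i = q i" if "i \<in> A - {a, b}" for i
    using inside[OF that] by (auto simp: Transposition.transpose_def)
  have "Transposition.transpose a b \<circ> q permutes A"
    using assms by (intro permutes_compose permutes_subset[OF perm] permutes_swap_id) auto
  moreover have "(Transposition.transpose a b \<circ> q) i \<noteq> i \<and> (Transposition.transpose a b \<circ> q) ((Transposition.transpose a b \<circ> q) i) = i"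
    if "i \<in> A" for i
  proof (cases "i \<in> {a, b}")
    case True
    then show ?thesis using ab \<open>b \<noteq> a\<close> by auto
  next
    case False
    then have i: "i \<in> A - {a, b}" using that by blast
    show ?thesis
      unfolding rest[OF i] rest[OF inside[OF i]] by (rule inv[OF i])
  qed
  ultimately show "Transposition.transpose a b \<circ> q \<in> fpf_involutions A"
    unfolding fpf_involutions_def by blast
qed

text \<open>The inverse operation, deleting the edge at \<open>a\<close>: composing with the same
  transposition again turns \<open>a\<close> and its partner into fixed points.\<close>

lemma fpf_involutions_remove_pair:
  assumes "a \<in> A" and p: "p \<in> fpf_involutions A"
  shows "p a \<in> A - {a}" and "Transposition.transpose a (p a) \<circ> p \<in> fpf_involutions (A - {a, p a})"
proof -
  have perm: "p permutes A"
    and inv: "\<And>i. i \<in> A \<Longrightarrow> p i \<noteq> i \<and> p (p i) = i"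
    using p by (auto simp: fpf_involutions_def)
  show pa: "p a \<in> A - {a}"
    using permutes_in_image[OF perm] inv[OF \<open>a \<in> A\<close>] \<open>a \<in> A\<close> by blast
  \<comment> \<open>If \<open>p i\<close> were \<open>a\<close> or \<open>p a\<close>, applying
    \<open>p\<close> once more would give \<open>i = p a\<close> or \<open>i = a\<close>.\<close>
  have inside: "p i \<in> A - {a, p a}" if "i \<in> A - {a, p a}" for i
    using that permutes_in_image[OF perm, of i] inv[of i] inv[OF \<open>a \<in> A\<close>]
    by (metis DiffD1 DiffD2 DiffI insertCI insertE singletonD)
  have rest: "(Transposition.transpose a (p a) \<circ> p) i = p i" if "i \<in> A - {a, p a}" for i
    using inside[OF that] by (auto simp: Transposition.transpose_def)
  have ab: "(Transposition.transpose a (p a) \<circ> p) a = a" "(Transposition.transpose a (p a) \<circ> p) (p a) = p a"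
    using inv[OF \<open>a \<in> A\<close>] by simp_all
  have "Transposition.transpose a (p a) \<circ> p permutes A"
    using pa \<open>a \<in> A\<close> by (intro permutes_compose perm permutes_swap_id) auto
  then have "Transposition.transpose a (p a) \<circ> p permutes A - {a, p a}"
    by (rule permutes_superset) (use ab in auto)
  moreover have "(Transposition.transpose a (p a) \<circ> p) i \<noteq> i \<and>
      (Transposition.transpose a (p a) \<circ> p) ((Transposition.transpose a (p a) \<circ> p) i) = i" if "i \<in> A - {a, p a}" for i
    unfolding rest[OF that] rest[OF inside[OF that]] using inv that by blast
  ultimately show "Transposition.transpose a (p a) \<circ> p \<in> fpf_involutions (A - {a, p a})"
    unfolding fpf_involutions_def by blast
qed

text \<open>Fix a point \<open>a\<close>. A matching amounts to a partner \<open>b\<close> of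
  \<open>a\<close> together with a matching of the remaining points, which yields the recursion of
  the double factorial.\<close>

lemma card_fpf_involutions:
  assumes "finite A" "card A = 2 * m"
  shows "card (fpf_involutions A) = double_factorial (2 * m - 1)"
  using assms
proof (induction m arbitrary: A)
  case 0
  then have "fpf_involutions A = {id}"
    by (auto simp: fpf_involutions_def)
  then show ?case by simp
next
  case (Suc m)
  then obtain a where "a \<in> A" by fastforce
  let ?B = "SIGMA b:A - {a}. fpf_involutions (A - {a, b})"
  have "bij_betw (\<lambda>(b, q). Transposition.transpose a b \<circ> q) ?B (fpf_involutions A)"
  proof (rule bij_betw_byWitness[where f' = "\<lambda>p. (p a, Transposition.transpose a (p a) \<circ> p)"])
    show "\<forall>x\<in>?B. (\<lambda>p. (p a, Transposition.transpose a (p a) \<circ> p)) ((\<lambda>(b, q). Transposition.transpose a b \<circ> q) x) = x"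
      using fpf_involutions_insert_pair(2)[OF \<open>a \<in> A\<close>] by (auto simp: o_assoc[symmetric] fun_eq_iff)
    show "\<forall>p\<in>fpf_involutions A. (\<lambda>(b, q). Transposition.transpose a b \<circ> q) (p a, Transposition.transpose a (p a) \<circ> p) = p"
      by (auto simp: fun_eq_iff)
    show "(\<lambda>(b, q). Transposition.transpose a b \<circ> q) ` ?B \<subseteq> fpf_involutions A"
      using fpf_involutions_insert_pair(1)[OF \<open>a \<in> A\<close>] by auto
    show "(\<lambda>p. (p a, Transposition.transpose a (p a) \<circ> p)) ` fpf_involutions A \<subseteq> ?B"
      using fpf_involutions_remove_pair[OF \<open>a \<in> A\<close>] by auto
  qed
  then have "card (fpf_involutions A) = card ?B"
    by (simp add: bij_betw_same_card)
  also have "\<dots> = (\<Sum>b\<in>A - {a}. card (fpf_involutions (A - {a, b})))"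
    using Suc.prems by (intro card_SigmaI) (auto intro: finite_fpf_involutions)
  also have "\<dots> = (\<Sum>b\<in>A - {a}. double_factorial (2 * m - 1))"
  proof (rule sum.cong[OF refl])
    fix b assume "b \<in> A - {a}"
    then have "card (A - {a, b}) = 2 * m"
      using Suc.prems \<open>a \<in> A\<close> by (subst card_Diff_subset) auto
    then show "card (fpf_involutions (A - {a, b})) = double_factorial (2 * m - 1)"
      using Suc by simp
  qed
  also have "\<dots> = (2 * m + 1) * double_factorial (2 * m - 1)"
    using Suc.prems \<open>a \<in> A\<close> by simp
  \<comment> \<open>For \<open>m = 0\<close> the subtraction \<open>2 * m - 1\<close> truncates to
    0, so the recursive equation applies only to positive \<open>m\<close>; at 0 both sides are
    1.\<close>
  also have "\<dots> = double_factorial (2 * Suc m - 1)"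
    by (cases m) simp_all
  finally show ?case .
qed

text \<open>Removing one pair {a, b} from \<open>p\<close> negates the sign and splits off the
  factor \<open>x a b * x b a = -1\<close>, so the two changes cancel. The index set is arbitrary so
  that the induction can pass to \<open>A - {a, b}\<close>.\<close>

lemma sign_times_prod_fpf_involution:
  fixes x :: "'a \<Rightarrow> 'a \<Rightarrow> real"
  assumes "finite A" "p \<in> fpf_involutions A"
    and "\<And>i j. i \<in> A \<Longrightarrow> j \<in> A \<Longrightarrow> i \<noteq> j \<Longrightarrow> x i j * x j i = -1"
  shows "of_int (sign p) * (\<Prod>i\<in>A. x i (p i)) = 1"
  using assms
proof (induction "card A" arbitrary: A p rule: less_induct)
  case less
  show ?case
  proof (cases "A = {}")
    case True
    then show ?thesis using less.prems by (auto simp: fpf_involutions_def)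
  next
    case False
    then obtain a where "a \<in> A" by blast
    define b where "b = p a"
    define q where "q = Transposition.transpose a b \<circ> p"
    have b: "b \<in> A" "b \<noteq> a" and q: "q \<in> fpf_involutions (A - {a, b})"
      using fpf_involutions_remove_pair[OF \<open>a \<in> A\<close> less.prems(2)] by (auto simp: b_def q_def)
    have p_eq: "p = Transposition.transpose a b \<circ> q"
      by (auto simp: q_def fun_eq_iff)
    note pq = fpf_involutions_insert_pair[OF \<open>a \<in> A\<close> b q, folded p_eq]
    have "permutation q"
      using q less.prems(1) by (auto simp: fpf_involutions_def permutation_permutes)
    then have sign: "sign p = - sign q"
      unfolding p_eq using b by (subst sign_compose) (auto simp: sign_swap_id permutation_swap_id)
    have "(\<Prod>i\<in>A. x i (p i)) = (\<Prod>i\<in>A - {a, b}. x i (p i)) * (\<Prod>i\<in>{a, b}. x i (p i))"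
      using less.prems(1) \<open>a \<in> A\<close> b by (intro prod.subset_diff) auto
    also have "(\<Prod>i\<in>A - {a, b}. x i (p i)) = (\<Prod>i\<in>A - {a, b}. x i (q i))"
      using pq(4) by (intro prod.cong) auto
    also have "(\<Prod>i\<in>{a, b}. x i (p i)) = -1"
      using b \<open>a \<in> A\<close> pq(2,3) less.prems(3)[of a b] by auto
    finally have "of_int (sign p) * (\<Prod>i\<in>A. x i (p i))
        = of_int (sign q) * (\<Prod>i\<in>A - {a, b}. x i (q i))"
      by (simp add: sign)
    also have "\<dots> = 1"
      using less.prems \<open>a \<in> A\<close> q by (intro less.hyps psubset_card_mono) auto
    finally show ?thesis .
  qed
qed

section \<open>Averaging the permutation terms over Seidel matrices\<close>

text \<open>Lets membership be checked entry by entry, without exhibiting a tournament. For entries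
  \<plusminus>1, the product condition is skew-symmetry.\<close>

lemma seidel_matrices_eq:
  "seidel_matrices n = {X \<in> carrier_mat n n. (\<forall>i<n. X $$ (i, i) = 0) \<and>
     (\<forall>i<n. \<forall>j<n. i \<noteq> j \<longrightarrow> X $$ (i, j) \<in> {1, -1} \<and> X $$ (i, j) * X $$ (j, i) = -1)}"
    (is "_ = ?R")
proof (intro subset_antisym subsetI)
  fix X assume "X \<in> seidel_matrices n"
  then obtain T where T: "is_tournament n T" and X: "X = seidel_matrix n T"
    by (auto simp: seidel_matrices_def)
  have "X $$ (i, j) \<in> {1, -1} \<and> X $$ (i, j) * X $$ (j, i) = -1"
    if "i < n" "j < n" "i \<noteq> j" for i j
  proof -
    have "Suc i \<in> {1..n}" "Suc j \<in> {1..n}" "Suc i \<noteq> Suc j"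
      using that by auto
    then have "(Suc i, Suc j) \<in> parcs T \<longleftrightarrow> (Suc j, Suc i) \<notin> parcs T"
      using T unfolding is_tournament_def by blast
    then show ?thesis
      using that by (cases "(Suc i, Suc j) \<in> parcs T") (simp_all add: X seidel_matrix_def)
  qed
  then show "X \<in> ?R"
    by (auto simp: X seidel_matrix_def)
next
  fix X assume "X \<in> ?R"
  then have dim: "X \<in> carrier_mat n n" and diag: "\<And>i. i < n \<Longrightarrow> X $$ (i, i) = 0"
    and pm: "\<And>i j. i < n \<Longrightarrow> j < n \<Longrightarrow> i \<noteq> j \<Longrightarrow> X $$ (i, j) = 1 \<or> X $$ (i, j) = -1"
    and skew: "\<And>i j. i < n \<Longrightarrow> j < n \<Longrightarrow> i \<noteq> j \<Longrightarrow> X $$ (i, j) * X $$ (j, i) = -1"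
    by auto
  \<comment> \<open>The arcs in matrix indices, read off from the entries 1; \<open>T\<close> shifts
    them by \<open>Suc\<close> to vertices.\<close>
  define E where "E = {(i, j). i < n \<and> j < n \<and> i \<noteq> j \<and> X $$ (i, j) = 1}"
  define T where "T = \<lparr>pverts = {1..n}, parcs = map_prod Suc Suc ` E\<rparr>"
  have arcs: "(Suc i, Suc j) \<in> parcs T \<longleftrightarrow> (i, j) \<in> E" for i j
    by (auto simp: T_def)
  have "finite E"
    by (rule finite_subset[of _ "{..<n} \<times> {..<n}"]) (auto simp: E_def)
  then have "pair_digraph T"
    by unfold_locales (auto simp: T_def E_def)
  moreover have "(i, j) \<in> parcs T \<longleftrightarrow> (j, i) \<notin> parcs T"
    if "i \<in> {1..n}" "j \<in> {1..n}" "i \<noteq> j" for i j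
  proof -
    obtain k l where kl: "i = Suc k" "j = Suc l" "k < n" "l < n" "k \<noteq> l"
      by (rule that[of "i - 1" "j - 1"]) (use \<open>i \<in> {1..n}\<close> \<open>j \<in> {1..n}\<close> \<open>i \<noteq> j\<close> in auto)
    then show ?thesis
      using pm[of k l] pm[of l k] skew[of k l] unfolding kl(1,2) arcs by (auto simp: E_def)
  qed
  moreover have "pverts T = {1..n}"
    by (simp add: T_def)
  ultimately have "is_tournament n T"
    unfolding is_tournament_def by blast
  moreover have "X = seidel_matrix n T"
  proof (rule eq_matI)
    fix i j assume "i < dim_row (seidel_matrix n T)" "j < dim_col (seidel_matrix n T)"
    then have ij: "i < n" "j < n" by (simp_all add: seidel_matrix_def)
    then show "X $$ (i, j) = seidel_matrix n T $$ (i, j)"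
      using diag[of i] pm[of i j] by (auto simp: seidel_matrix_def arcs E_def)
  qed (use dim in \<open>auto simp: seidel_matrix_def\<close>)
  ultimately show "X \<in> seidel_matrices n"
    by (auto simp: seidel_matrices_def)
qed

text \<open>Reversing the arc between \<open>a\<close> and \<open>p a\<close> is a bijection of the
  Seidel matrices that negates exactly one factor of the product, so the sum equals its own
  negative.\<close>

lemma sum_seidel_prod_eq_0:
  assumes p: "p permutes {0..<n}" and "a < n" and pp: "p (p a) \<noteq> a"
  shows "(\<Sum>X\<in>seidel_matrices n. \<Prod>i = 0..<n. X $$ (i, p i)) = 0"
proof -
  define b where "b = p a"
  have lt: "p i < n" if "i < n" for i
    using permutes_in_image[OF p, of i] that by simp
  \<comment> \<open>If \<open>p a = a\<close>, then also \<open>p (p a) = a\<close>, against the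
    assumption.\<close>
  have ab: "b < n" "b \<noteq> a"
    using lt \<open>a < n\<close> pp by (auto simp: b_def)
  \<comment> \<open>Both entries of the pair change sign, which keeps the matrix
    skew-symmetric.\<close>
  define flip :: "real mat \<Rightarrow> real mat" where
    "flip X = mat n n (\<lambda>(i, j). if (i, j) = (a, b) \<or> (i, j) = (b, a) then - X $$ (i, j) else X $$ (i, j))"
    for X
  have flip: "flip X $$ (i, j) =
      (if (i, j) = (a, b) \<or> (i, j) = (b, a) then - X $$ (i, j) else X $$ (i, j))"
    if "i < n" "j < n" for X i j
    using that by (simp add: flip_def)
  have carrier: "flip X \<in> carrier_mat n n" for X
    by (simp add: flip_def)
  have flip_in: "flip X \<in> seidel_matrices n" if "X \<in> seidel_matrices n" for X
    using that ab \<open>a < n\<close> carrier[of X] unfolding seidel_matrices_eq by (auto simp: flip)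
  have flip_flip: "flip (flip X) = X" if "X \<in> seidel_matrices n" for X
    using that carrier[of "flip X"] unfolding seidel_matrices_eq by (intro eq_matI) (auto simp: flip)
  have neg: "(\<Prod>i = 0..<n. flip X $$ (i, p i)) = - (\<Prod>i = 0..<n. X $$ (i, p i))" for X
  proof -
    have "(\<Prod>i = 0..<n. flip X $$ (i, p i)) = flip X $$ (a, b) * (\<Prod>i\<in>{0..<n} - {a}. flip X $$ (i, p i))"
      using \<open>a < n\<close> by (subst prod.remove[of _ a]) (auto simp: b_def)
    also have "flip X $$ (a, b) = - X $$ (a, b)"
      using \<open>a < n\<close> ab by (simp add: flip)
    \<comment> \<open>The other flipped entry, \<open>(b, a)\<close>, does not occur here: row
      \<open>b\<close> contributes the entry in column \<open>p b\<close>, and \<open>p b\<close>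
      differs from \<open>a\<close>.\<close>
    also have "(\<Prod>i\<in>{0..<n} - {a}. flip X $$ (i, p i)) = (\<Prod>i\<in>{0..<n} - {a}. X $$ (i, p i))"
      using pp by (intro prod.cong) (auto simp: flip lt b_def)
    also have "- X $$ (a, b) * \<dots> = - (\<Prod>i = 0..<n. X $$ (i, p i))"
      using \<open>a < n\<close> by (subst (2) prod.remove[of _ a]) (auto simp: b_def)
    finally show ?thesis .
  qed
  have "(\<Sum>X\<in>seidel_matrices n. \<Prod>i = 0..<n. X $$ (i, p i))
      = (\<Sum>X\<in>seidel_matrices n. \<Prod>i = 0..<n. flip X $$ (i, p i))"
    by (rule sum.reindex_bij_witness[of _ flip flip]) (auto simp: flip_in flip_flip)
  then show ?thesis
    by (simp add: neg sum_negf)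
qed

text \<open>After exchanging the two sums of the Leibniz expansion, each permutation can be treated
  separately: only the fixed-point-free involutions survive, with contribution 1 for every
  matrix.\<close>

lemma sum_det_seidel_matrices:
  "(\<Sum>X\<in>seidel_matrices n. Determinant.det X)
     = real (card (seidel_matrices n)) * real (card (fpf_involutions {0..<n}))"
proof -
  let ?S = "seidel_matrices n" and ?P = "{p. p permutes {0..<n}}" and ?F = "fpf_involutions {0..<n}"
  let ?t = "\<lambda>X p. signof p * (\<Prod>i = 0..<n. X $$ (i, p i)) :: real"
  have zero: "(\<Sum>X\<in>?S. ?t X p) = 0" if p: "p \<in> ?P - ?F" for p
  proof -
    obtain a where "a < n" and "p a = a \<or> p (p a) \<noteq> a"
      using p by (auto simp: fpf_involutions_def)
    then consider "p a = a" | "p (p a) \<noteq> a" by blast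
    then have "(\<Sum>X\<in>?S. \<Prod>i = 0..<n. X $$ (i, p i)) = 0"
    proof cases
      case 1
      then show ?thesis
        \<comment> \<open>A fixed point \<open>a\<close> puts the diagonal entry
          \<open>(a, a)\<close>, which is 0, into every product.\<close>
        using \<open>a < n\<close> by (intro sum.neutral ballI prod_zero) (auto simp: seidel_matrices_eq intro!: bexI[of _ a])
    next
      case 2
      then show ?thesis
        using p \<open>a < n\<close> by (intro sum_seidel_prod_eq_0) auto
    qed
    then show ?thesis
      by (simp flip: sum_distrib_left)
  qed
  have one: "?t X p = 1" if X: "X \<in> ?S" and p: "p \<in> ?F" for X p
    using X p by (intro sign_times_prod_fpf_involution) (auto simp: seidel_matrices_eq)
  have "(\<Sum>X\<in>?S. Determinant.det X) = (\<Sum>X\<in>?S. \<Sum>p\<in>?P. ?t X p)"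
    by (intro sum.cong refl det_def') (auto simp: seidel_matrices_eq)
  also have "\<dots> = (\<Sum>p\<in>?P. \<Sum>X\<in>?S. ?t X p)"
    by (rule sum.swap)
  also have "\<dots> = (\<Sum>p\<in>?F. \<Sum>X\<in>?S. ?t X p)"
    using zero by (intro sum.mono_neutral_right finite_permutations) (auto simp: fpf_involutions_def)
  also have "\<dots> = (\<Sum>p\<in>?F. \<Sum>X\<in>?S. 1)"
    using one by (intro sum.cong refl) auto
  finally show ?thesis by simp
qed

theorem theorem4p1:
  fixes n m :: nat
  assumes "n = 2 * m" and "n > 0"
  shows "measure_pmf.expectation (pmf_of_set (seidel_matrices n)) Determinant.det
           = real (double_factorial (n - 1))"
proof -
  \<comment> \<open>A positive cardinality gives finiteness and nonemptiness at once; both are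
    required to write the expectation as the sum divided by the cardinality.\<close>
  have "card (seidel_matrices n) > 0"
    by (simp add: card_seidel_matrices)
  then have "seidel_matrices n \<noteq> {}" "finite (seidel_matrices n)"
    by (auto simp: card_gt_0_iff)
  then have "measure_pmf.expectation (pmf_of_set (seidel_matrices n)) Determinant.det
      = real (card (fpf_involutions {0..<n}))"
    by (simp add: integral_pmf_of_set sum_det_seidel_matrices)
  also have "\<dots> = real (double_factorial (n - 1))"
    using assms card_fpf_involutions[of "{0..<n}" m] by simp
  finally show ?thesis .
qed

end
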